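(* Let $G$ be an ADE graph and $(A,\cdot,{}^* )$ a double triangle algebra of $G$, $A=End^{gr}(\mathcal E)$. For $\xi_1,\xi_1'\in B_{n_1}$ and $\xi_2,\xi_2'\in B_{n_2}$ (the fixed bases of $\mathcal E_{n_1}$, $\mathcal E_{n_2}$), $$(\xi_1\otimes\xi_1')\cdot(\xi_2\otimes\xi_2')=\sum_{n_3}\ \sum_{\xi_3,\xi_3'\in B_{n_3}}P^{\xi_1\xi_2\xi_3}_{\xi_1'\xi_2'\xi_3'}\ \xi_3\otimes\xi_3',$$ where $$P^{\xi_1\xi_2\xi_3}_{\xi_1'\xi_2'\xi_3'}=\sum_{x,\eta_1,\eta_2,\eta_3}\Phi^x_{\eta_1\eta_2}(\xi_1\otimes\xi_1')\,\Phi^x_{\eta_2\eta_3}(\xi_2\otimes\xi_2')\,\Psi^x_{\eta_1\eta_3}(\xi_3\otimes\xi_3'),$$ the sum being over irreducible representations $x$ of $A$ and indices $\eta_1,\eta_2,\eta_3$ of $x$, and $\Psi^x$ denoting the inverse cells.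
   Context: Graph and paths. $G$ is an ADE graph (simply laced Dynkin diagram) with adjacency matrix $M$; $\beta$ is the largest eigenvalue of $M$ and $\mu=(\mu_v)$ its Perron–Frobenius eigenvector, normalized so that its smallest component is $1$. An elementary path of length $n\ge 0$ is a sequence $\xi=(v_0,\dots,v_n)$ of vertices with consecutive vertices adjacent; $s(\xi)=v_0$, $r(\xi)=v_n$, $\#\xi=n$, and $\tilde\xi=(v_n,\dots,v_0)$ (extended linearly). $\mathcal P=\bigoplus_n\mathcal P_n$ is the complex vector space with basis the elementary paths, graded by length. Concatenation: $\xi\star\xi'=\delta_{r(\xi)s(\xi')}\,(v_0,\dots,v_n,v_1',\dots,v_m')$. For $k\ge1$ the operator $c_k$ kills paths of length $n\le k$ and for $n>k$ is given by $c_k(v_0,\dots,v_n)=\sqrt{\mu_{v_k}/\mu_{v_{k+1}}}\;\delta_{v_{k-1},v_{k+1}}\,(v_0,\dots,v_{k-1},v_{k+2},\dots,v_n)$. The space of essential paths is $\mathcal E=\bigcap_k\ker c_k=\bigoplus_n\mathcal E_n$, which is finite dimensional for ADE graphs. Endomorphisms. Using the symmetric bilinear form on $\mathcal P_n$ for which elementary paths are orthonormal, the duals of $\mathcal P_n$ and $\mathcal E_n$ are identified with $\mathcal P_n$ and $\mathcal E_n$, so $End^{gr}(\mathcal P)=\bigoplus_n\mathcal P_n\otimes\mathcal P_n$ and $End^{gr}(\mathcal E)=\bigoplus_n\mathcal E_n\otimes\mathcal E_n$. For each $n$ fix a basis $B_n$ of $\mathcal E_n$ consisting of real combinations of elementary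 paths and orthonormal for this form. DTA. A double triangle algebra of $G$ is a finite-dimensional unital $C^*$-algebra $(A,\cdot,{}^* )$ with underlying vector space $A=End^{gr}(\mathcal E)$ (the product $\cdot$ is not composition of endomorphisms), together with a set of "fundamental" irreducible matrix $*$-representations $\Phi^f$ of $A$, whose matrix indices $\alpha,\beta$ are the length-one elementary paths, such that: (0) $\Phi^f_{\alpha\beta}(\xi\otimes\xi')=0$ unless $s(\alpha)=s(\xi)$, $r(\alpha)=s(\xi')$, $s(\beta)=r(\xi)$, $r(\beta)=r(\xi')$; and for $\#\xi=\#\xi'=0$, $\Phi^f_{\alpha\alpha}(\xi\otimes\xi')=\delta_{s(\alpha)\xi}\delta_{r(\alpha)\xi'}$. (iii) Concatenation: $\Phi^f_{\alpha\beta}((\xi_1\star\xi_2)\otimes(\xi_1'\star\xi_2'))=\Phi^f_{\alpha\gamma}(\xi_1\otimes\xi_1')\,\Phi^f_{\gamma\beta}(\xi_2\otimes\xi_2')$, where $\gamma$ is the edge from $r(\xi_1)$ to $r(\xi_1')$ (zero if there is none); this defines $\Phi^f$ on all of $End^{gr}(\mathcal P)$ from its values on paths of length $0$ and $1$. (i) Unitarity: for elementary paths $\xi,\lambda$ of length $n$, $\sum_{\alpha,\xi'}\overline{\Phi^f_{\alpha\beta}(\xi\otimes\xi')}\,\Phi^f_{\alpha\eta}(\lambda\otimes\xi')=\delta_{\beta\eta}\delta_{\xi\lambda}$ (sum over edges $\alpha$ and elementary $\xi'$ of length $n$). (ii) Reflection: for elementary $\xi,\xi'$ of equal length, with $c=\sqrt{\mu_{r(\xi)}\mu_{s(\xi')}/(\mu_{s(\xi)}\mu_{r(\xi')})}$,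 $\Phi^f_{\alpha\beta}(\xi\otimes\xi')=c\,\overline{\Phi^f_{\beta\alpha}(\tilde\xi\otimes\tilde\xi')}=c\,\overline{\Phi^f_{\tilde\alpha\tilde\beta}(\xi'\otimes\xi)}$. (4) Tensor products of representations are given by $\Phi^{f\otimes f'}_{\alpha\star\beta,\alpha'\star\beta'}(\xi\otimes\xi')=\sum_{\xi_i}\Phi^f_{\alpha\alpha'}(\xi\otimes\xi_i)\,\Phi^{f'}_{\beta\beta'}(\xi_i\otimes\xi')$ (sum over elementary paths $\xi_i$ of length $\#\xi$; iterated similarly); every irreducible representation of $A$ occurs in the decomposition of tensor products of fundamental ones. Irreps and cells. $x$ runs over the irreducible representations of $A$, realized as matrix $*$-representations $\Phi^x$. The matrix units $E^x_{\eta\eta'}\in A$ are the elements with $\Phi^y_{\alpha\beta}(E^x_{\eta\eta'})=\delta_{xy}\delta_{\alpha\eta}\delta_{\beta\eta'}$. The inverse cells $\Psi^x_{\eta\eta'}(\xi\otimes\xi')$ (for $\xi,\xi'\in B_n$) are the numbers forming the inverse of the matrix of the $\Phi^x_{\eta\eta'}(\xi\otimes\xi')$: $\sum_{x,\eta,\eta'}\Psi^x_{\eta\eta'}(\xi_1\otimes\xi_1')\,\Phi^x_{\eta\eta'}(\xi_2\otimes\xi_2')=\delta_{\xi_1\xi_2}\delta_{\xi_1'\xi_2'}$; equivalently $E^x_{\eta\eta'}=\sum_n\sum_{\xi,\xi'\in B_n}\Psi^x_{\eta\eta'}(\xi\otimes\xi')\,\xi\otimes\xi'$. *)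

theory Defs
  imports "HOL-Analysis.Analysis" "HOL-Library.Function_Algebras"
begin

section \<open>Complex-valued functions as a vector space\<close>

definition cscale :: "complex \<Rightarrow> ('b \<Rightarrow> complex) \<Rightarrow> 'b \<Rightarrow> complex" where
  "cscale c f = (\<lambda>x. c * f x)"

global_interpretation cfun: vector_space cscale
  by unfold_locales (auto simp: cscale_def fun_eq_iff algebra_simps)

definition basis_vec :: "'b \<Rightarrow> 'b \<Rightarrow> complex" where
  "basis_vec p = (\<lambda>q. of_bool (q = p))"

text \<open>Linear extension to finitely supported vectors of a map given on the basis vectors.\<close>

definition lin_ext :: "('b \<Rightarrow> complex) \<Rightarrow> ('b \<Rightarrow> complex) \<Rightarrow> complex" where
  "lin_ext \<phi> t = (\<Sum>p | t p \<noteq> 0. t p * \<phi> p)"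

definition tensor :: "('b \<Rightarrow> complex) \<Rightarrow> ('b \<Rightarrow> complex) \<Rightarrow> 'b \<times> 'b \<Rightarrow> complex" where
  "tensor f g = (\<lambda>(p, q). f p * g q)"

section \<open>ADE graphs\<close>

text \<open>The vertices of a Dynkin diagram of rank \<open>n\<close> are numbered \<open>0, \<dots>, n - 1\<close>. In types D and E
  the last vertex is the one attached to the chain formed by the others.\<close>

definition dynkin_A :: "nat \<Rightarrow> nat set set" where
  "dynkin_A n = {{i, Suc i} | i. Suc i < n}"

definition dynkin_D :: "nat \<Rightarrow> nat set set" where
  "dynkin_D n = insert {n - 3, n - 1} (dynkin_A (n - 1))"

definition dynkin_E :: "nat \<Rightarrow> nat set set" where
  "dynkin_E n = insert {2, n - 1} (dynkin_A (n - 1))"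

definition ADE_graph :: "('v::finite \<Rightarrow> 'v \<Rightarrow> bool) \<Rightarrow> bool" where
  "ADE_graph adj \<longleftrightarrow> (\<exists>n Es h.
     (n \<ge> 1 \<and> Es = dynkin_A n \<or> n \<ge> 4 \<and> Es = dynkin_D n \<or> n \<in> {6, 7, 8} \<and> Es = dynkin_E n) \<and>
     bij_betw h UNIV {..<n} \<and> (\<forall>u v. adj u v \<longleftrightarrow> {h u, h v} \<in> Es))"

definition adj_matrix :: "('v::finite \<Rightarrow> 'v \<Rightarrow> bool) \<Rightarrow> real ^ 'v ^ 'v" where
  "adj_matrix adj = (\<chi> u v. of_bool (adj u v))"

definition eigenvalue_of :: "real ^ 'v ^ 'v::finite \<Rightarrow> real \<Rightarrow> bool" where
  "eigenvalue_of M b \<longleftrightarrow> (\<exists>x. x \<noteq> 0 \<and> M *v x = b *s x)"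

definition perron_frobenius :: "('v::finite \<Rightarrow> 'v \<Rightarrow> bool) \<Rightarrow> real \<Rightarrow> real ^ 'v \<Rightarrow> bool" where
  "perron_frobenius adj \<beta> \<mu> \<longleftrightarrow>
     eigenvalue_of (adj_matrix adj) \<beta> \<and> (\<forall>b. eigenvalue_of (adj_matrix adj) b \<longrightarrow> b \<le> \<beta>) \<and>
     adj_matrix adj *v \<mu> = \<beta> *s \<mu> \<and> Min (range (\<lambda>v. \<mu> $ v)) = 1"

section \<open>Paths and essential paths\<close>

text \<open>An elementary path of length \<open>n\<close> is the list of its \<open>n + 1\<close> vertices; \<open>hd\<close>, \<open>last\<close> and
  \<open>rev\<close> are its source, its range and its reversal.\<close>

definition elem_paths :: "('v \<Rightarrow> 'v \<Rightarrow> bool) \<Rightarrow> nat \<Rightarrow> 'v list set" where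
  "elem_paths adj n = {p. length p = Suc n \<and> successively adj p}"

definition path_space :: "('v \<Rightarrow> 'v \<Rightarrow> bool) \<Rightarrow> ('v list \<Rightarrow> complex) set" where
  "path_space adj = {f. finite {p. f p \<noteq> 0} \<and> {p. f p \<noteq> 0} \<subseteq> (\<Union>n. elem_paths adj n)}"

definition path_space_deg :: "('v \<Rightarrow> 'v \<Rightarrow> bool) \<Rightarrow> nat \<Rightarrow> ('v list \<Rightarrow> complex) set" where
  "path_space_deg adj n = {f \<in> path_space adj. {p. f p \<noteq> 0} \<subseteq> elem_paths adj n}"

definition path_concat :: "'v list \<Rightarrow> 'v list \<Rightarrow> 'v list \<Rightarrow> complex" where
  "path_concat p q = (if last p = hd q then basis_vec (p @ tl q) else 0)"

definition c_elem :: "real ^ 'v \<Rightarrow> nat \<Rightarrow> 'v::finite list \<Rightarrow> 'v list \<Rightarrow> complex" where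
  "c_elem \<mu> k p =
     (if length p - 1 > k \<and> p ! (k - 1) = p ! (k + 1)
      then cscale (complex_of_real (sqrt (\<mu> $ (p ! k) / \<mu> $ (p ! (k + 1)))))
             (basis_vec (take k p @ drop (k + 2) p))
      else 0)"

definition c_op :: "real ^ 'v \<Rightarrow> nat \<Rightarrow> ('v::finite list \<Rightarrow> complex) \<Rightarrow> 'v list \<Rightarrow> complex" where
  "c_op \<mu> k f = (\<lambda>q. lin_ext (\<lambda>p. c_elem \<mu> k p q) f)"

definition essential :: "('v::finite \<Rightarrow> 'v \<Rightarrow> bool) \<Rightarrow> real ^ 'v \<Rightarrow> ('v list \<Rightarrow> complex) set" where
  "essential adj \<mu> = {f \<in> path_space adj. \<forall>k\<ge>1. c_op \<mu> k f = 0}"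

definition essential_deg ::
  "('v::finite \<Rightarrow> 'v \<Rightarrow> bool) \<Rightarrow> real ^ 'v \<Rightarrow> nat \<Rightarrow> ('v list \<Rightarrow> complex) set" where
  "essential_deg adj \<mu> n = essential adj \<mu> \<inter> path_space_deg adj n"

text \<open>\<open>End\<^sup>g\<^sup>r\<close> of the graded space with homogeneous components \<open>W n\<close>, that is, the direct sum of
  the \<open>W n \<otimes> W n\<close>, realised inside the functions on pairs of paths.\<close>

definition End_gr :: "(nat \<Rightarrow> ('b \<Rightarrow> complex) set) \<Rightarrow> ('b \<times> 'b \<Rightarrow> complex) set" where
  "End_gr W = cfun.span (\<Union>n. {tensor f g | f g. f \<in> W n \<and> g \<in> W n})"

definition path_form ::
  "('v \<Rightarrow> 'v \<Rightarrow> bool) \<Rightarrow> nat \<Rightarrow> ('v list \<Rightarrow> complex) \<Rightarrow> ('v list \<Rightarrow> complex) \<Rightarrow> complex" where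
  "path_form adj n f g = (\<Sum>p\<in>elem_paths adj n. f p * g p)"

definition essential_basis ::
  "('v::finite \<Rightarrow> 'v \<Rightarrow> bool) \<Rightarrow> real ^ 'v \<Rightarrow> nat \<Rightarrow> ('v list \<Rightarrow> complex) set \<Rightarrow> bool" where
  "essential_basis adj \<mu> n B \<longleftrightarrow>
     cfun.independent B \<and> cfun.span B = essential_deg adj \<mu> n \<and>
     (\<forall>b\<in>B. \<forall>p. b p \<in> \<real>) \<and>
     (\<forall>b\<in>B. \<forall>b'\<in>B. path_form adj n b b' = of_bool (b = b'))"

section \<open>Finite-dimensional C*-algebras and their matrix representations\<close>

locale fd_cstar_algebra =
  fixes A :: "('b \<Rightarrow> complex) set"
    and mul :: "('b \<Rightarrow> complex) \<Rightarrow> ('b \<Rightarrow> complex) \<Rightarrow> 'b \<Rightarrow> complex"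
    and star :: "('b \<Rightarrow> complex) \<Rightarrow> 'b \<Rightarrow> complex"
    and one :: "'b \<Rightarrow> complex"
  assumes subspace: "cfun.subspace A"
    and finite_dim: "\<exists>S. finite S \<and> A \<subseteq> cfun.span S"
    and mult_closed: "\<lbrakk>a \<in> A; b \<in> A\<rbrakk> \<Longrightarrow> mul a b \<in> A"
    and mult_add_left: "\<lbrakk>a \<in> A; b \<in> A; c \<in> A\<rbrakk> \<Longrightarrow> mul (a + b) c = mul a c + mul b c"
    and mult_add_right: "\<lbrakk>a \<in> A; b \<in> A; c \<in> A\<rbrakk> \<Longrightarrow> mul a (b + c) = mul a b + mul a c"
    and mult_scale_left: "\<lbrakk>a \<in> A; b \<in> A\<rbrakk> \<Longrightarrow> mul (cscale z a) b = cscale z (mul a b)"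
    and mult_scale_right: "\<lbrakk>a \<in> A; b \<in> A\<rbrakk> \<Longrightarrow> mul a (cscale z b) = cscale z (mul a b)"
    and mult_assoc: "\<lbrakk>a \<in> A; b \<in> A; c \<in> A\<rbrakk> \<Longrightarrow> mul (mul a b) c = mul a (mul b c)"
    and one_closed: "one \<in> A"
    and mult_one_left: "a \<in> A \<Longrightarrow> mul one a = a"
    and mult_one_right: "a \<in> A \<Longrightarrow> mul a one = a"
    and star_closed: "a \<in> A \<Longrightarrow> star a \<in> A"
    and star_add: "\<lbrakk>a \<in> A; b \<in> A\<rbrakk> \<Longrightarrow> star (a + b) = star a + star b"
    and star_scale: "a \<in> A \<Longrightarrow> star (cscale z a) = cscale (cnj z) (star a)"
    and star_star: "a \<in> A \<Longrightarrow> star (star a) = a"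
    and star_mult: "\<lbrakk>a \<in> A; b \<in> A\<rbrakk> \<Longrightarrow> star (mul a b) = mul (star b) (star a)"
    and cstar_norm: "\<exists>N :: ('b \<Rightarrow> complex) \<Rightarrow> real.
          (\<forall>a\<in>A. N a \<ge> 0 \<and> (N a = 0 \<longleftrightarrow> a = 0)) \<and>
          (\<forall>a\<in>A. \<forall>b\<in>A. N (a + b) \<le> N a + N b) \<and>
          (\<forall>a\<in>A. \<forall>z. N (cscale z a) = cmod z * N a) \<and>
          (\<forall>a\<in>A. \<forall>b\<in>A. N (mul a b) \<le> N a * N b) \<and>
          (\<forall>a\<in>A. N (mul (star a) a) = (N a)\<^sup>2) \<and>
          (\<forall>s :: nat \<Rightarrow> 'b \<Rightarrow> complex. (\<forall>n. s n \<in> A) \<and>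
             (\<forall>e>0. \<exists>M. \<forall>m\<ge>M. \<forall>n\<ge>M. N (s m - s n) < e) \<longrightarrow>
             (\<exists>a\<in>A. (\<lambda>n. N (s n - a)) \<longlonglongrightarrow> 0))"

text \<open>A matrix representation with finite index set \<open>I\<close> is given by its matrix coefficients
  \<open>\<rho> i j :: A \<Rightarrow> \<complex>\<close> for \<open>i, j \<in> I\<close>.\<close>

definition matrix_rep ::
  "('b \<Rightarrow> complex) set \<Rightarrow> (('b \<Rightarrow> complex) \<Rightarrow> ('b \<Rightarrow> complex) \<Rightarrow> 'b \<Rightarrow> complex) \<Rightarrow> ('b \<Rightarrow> complex) \<Rightarrow>
   'i set \<Rightarrow> ('i \<Rightarrow> 'i \<Rightarrow> ('b \<Rightarrow> complex) \<Rightarrow> complex) \<Rightarrow> bool" where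
  "matrix_rep A mul one I \<rho> \<longleftrightarrow> finite I \<and>
     (\<forall>i\<in>I. \<forall>j\<in>I.
        (\<forall>a\<in>A. \<forall>b\<in>A. \<rho> i j (a + b) = \<rho> i j a + \<rho> i j b) \<and>
        (\<forall>a\<in>A. \<forall>z. \<rho> i j (cscale z a) = z * \<rho> i j a) \<and>
        (\<forall>a\<in>A. \<forall>b\<in>A. \<rho> i j (mul a b) = (\<Sum>k\<in>I. \<rho> i k a * \<rho> k j b)) \<and>
        \<rho> i j one = of_bool (i = j))"

definition star_preserving ::
  "('b \<Rightarrow> complex) set \<Rightarrow> (('b \<Rightarrow> complex) \<Rightarrow> 'b \<Rightarrow> complex) \<Rightarrow>
   'i set \<Rightarrow> ('i \<Rightarrow> 'i \<Rightarrow> ('b \<Rightarrow> complex) \<Rightarrow> complex) \<Rightarrow> bool" where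
  "star_preserving A star I \<rho> \<longleftrightarrow> (\<forall>i\<in>I. \<forall>j\<in>I. \<forall>a\<in>A. \<rho> i j (star a) = cnj (\<rho> j i a))"

definition coord_space :: "'i set \<Rightarrow> ('i \<Rightarrow> complex) set" where
  "coord_space I = {w. \<forall>i. i \<notin> I \<longrightarrow> w i = 0}"

definition irreducible_rep ::
  "('b \<Rightarrow> complex) set \<Rightarrow> (('b \<Rightarrow> complex) \<Rightarrow> ('b \<Rightarrow> complex) \<Rightarrow> 'b \<Rightarrow> complex) \<Rightarrow> ('b \<Rightarrow> complex) \<Rightarrow>
   'i set \<Rightarrow> ('i \<Rightarrow> 'i \<Rightarrow> ('b \<Rightarrow> complex) \<Rightarrow> complex) \<Rightarrow> bool" where
  "irreducible_rep A mul one I \<rho> \<longleftrightarrow> matrix_rep A mul one I \<rho> \<and> I \<noteq> {} \<and>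
     (\<forall>W. cfun.subspace W \<and> W \<subseteq> coord_space I \<and>
          (\<forall>a\<in>A. \<forall>w\<in>W. (\<lambda>i. if i \<in> I then \<Sum>j\<in>I. \<rho> i j a * w j else 0) \<in> W) \<longrightarrow>
          W = {0} \<or> W = coord_space I)"

definition rep_equiv ::
  "('b \<Rightarrow> complex) set \<Rightarrow> 'i set \<Rightarrow> ('i \<Rightarrow> 'i \<Rightarrow> ('b \<Rightarrow> complex) \<Rightarrow> complex) \<Rightarrow>
   'j set \<Rightarrow> ('j \<Rightarrow> 'j \<Rightarrow> ('b \<Rightarrow> complex) \<Rightarrow> complex) \<Rightarrow> bool" where
  "rep_equiv A I \<rho> J \<sigma> \<longleftrightarrow> (\<exists>S R.
     (\<forall>i\<in>I. \<forall>i'\<in>I. (\<Sum>j\<in>J. S i j * R j i') = of_bool (i = i')) \<and>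
     (\<forall>j\<in>J. \<forall>j'\<in>J. (\<Sum>i\<in>I. R j i * S i j') = of_bool (j = j')) \<and>
     (\<forall>a\<in>A. \<forall>i\<in>I. \<forall>j\<in>J. (\<Sum>i'\<in>I. \<rho> i i' a * S i' j) = (\<Sum>j'\<in>J. S i j' * \<sigma> j' j a)))"

fun direct_sum ::
  "('i \<Rightarrow> 'i \<Rightarrow> ('b \<Rightarrow> complex) \<Rightarrow> complex) \<Rightarrow> ('j \<Rightarrow> 'j \<Rightarrow> ('b \<Rightarrow> complex) \<Rightarrow> complex) \<Rightarrow>
   'i + 'j \<Rightarrow> 'i + 'j \<Rightarrow> ('b \<Rightarrow> complex) \<Rightarrow> complex" where
  "direct_sum \<rho> \<sigma> (Inl i) (Inl i') a = \<rho> i i' a"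
| "direct_sum \<rho> \<sigma> (Inr j) (Inr j') a = \<sigma> j j' a"
| "direct_sum \<rho> \<sigma> (Inl i) (Inr j') a = 0"
| "direct_sum \<rho> \<sigma> (Inr j) (Inl i') a = 0"

text \<open>The complement \<open>\<sigma>\<close> may have dimension \<open>m = 0\<close>.\<close>

definition occurs_in ::
  "('b \<Rightarrow> complex) set \<Rightarrow> (('b \<Rightarrow> complex) \<Rightarrow> ('b \<Rightarrow> complex) \<Rightarrow> 'b \<Rightarrow> complex) \<Rightarrow> ('b \<Rightarrow> complex) \<Rightarrow>
   'i set \<Rightarrow> ('i \<Rightarrow> 'i \<Rightarrow> ('b \<Rightarrow> complex) \<Rightarrow> complex) \<Rightarrow>
   'j set \<Rightarrow> ('j \<Rightarrow> 'j \<Rightarrow> ('b \<Rightarrow> complex) \<Rightarrow> complex) \<Rightarrow> bool" where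
  "occurs_in A mul one I \<rho> J \<tau> \<longleftrightarrow>
     (\<exists>m (\<sigma> :: nat \<Rightarrow> nat \<Rightarrow> ('b \<Rightarrow> complex) \<Rightarrow> complex).
        matrix_rep A mul one {..<m} \<sigma> \<and> rep_equiv A (I <+> {..<m}) (direct_sum \<rho> \<sigma>) J \<tau>)"

text \<open>A complete system of representatives, labelled by \<open>X\<close>, of the equivalence classes of
  irreducible representations, each realised as a matrix *-representation. Every finite index set
  can be renumbered as some \<open>{..<d}\<close>, so it suffices to quantify over those for completeness.\<close>

definition irrep_system ::
  "('b \<Rightarrow> complex) set \<Rightarrow> (('b \<Rightarrow> complex) \<Rightarrow> ('b \<Rightarrow> complex) \<Rightarrow> 'b \<Rightarrow> complex) \<Rightarrow>
   (('b \<Rightarrow> complex) \<Rightarrow> 'b \<Rightarrow> complex) \<Rightarrow> ('b \<Rightarrow> complex) \<Rightarrow>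
   'x set \<Rightarrow> ('x \<Rightarrow> 'i set) \<Rightarrow> ('x \<Rightarrow> 'i \<Rightarrow> 'i \<Rightarrow> ('b \<Rightarrow> complex) \<Rightarrow> complex) \<Rightarrow> bool" where
  "irrep_system A mul star one X I \<Phi> \<longleftrightarrow>
     (\<forall>x\<in>X. irreducible_rep A mul one (I x) (\<Phi> x) \<and> star_preserving A star (I x) (\<Phi> x)) \<and>
     (\<forall>x\<in>X. \<forall>y\<in>X. rep_equiv A (I x) (\<Phi> x) (I y) (\<Phi> y) \<longrightarrow> x = y) \<and>
     (\<forall>d (\<rho> :: nat \<Rightarrow> nat \<Rightarrow> ('b \<Rightarrow> complex) \<Rightarrow> complex).
        irreducible_rep A mul one {..<d} \<rho> \<longrightarrow> (\<exists>x\<in>X. rep_equiv A {..<d} \<rho> (I x) (\<Phi> x)))"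

section \<open>Double triangle algebras\<close>

text \<open>The cells \<open>\<Phi>f f \<alpha> \<beta> \<xi> \<xi>'\<close> are the values of the matrix coefficient \<open>(\<alpha>, \<beta>)\<close> of the fundamental
  representation \<open>f\<close> at the tensor product of the elementary paths \<open>\<xi>\<close> and \<open>\<xi>'\<close> (of equal length).
  \<open>cell_rep\<close> extends them linearly to \<open>End\<^sup>g\<^sup>r\<close> of the path space.\<close>

definition cell_rep ::
  "('v list \<Rightarrow> 'v list \<Rightarrow> 'v list \<Rightarrow> 'v list \<Rightarrow> complex) \<Rightarrow>
   'v list \<Rightarrow> 'v list \<Rightarrow> ('v list \<times> 'v list \<Rightarrow> complex) \<Rightarrow> complex" where
  "cell_rep \<phi> \<alpha> \<beta> t = lin_ext (\<lambda>(\<xi>, \<xi>'). \<phi> \<alpha> \<beta> \<xi> \<xi>') t"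

text \<open>Cells of the iterated tensor product of a non-empty list of \<open>k\<close> fundamental representations.
  Its index set consists of the composable sequences of \<open>k\<close> edges, encoded as the elementary
  paths \<open>p\<close> of length \<open>k\<close>; the first edge is \<open>take 2 p\<close>, the remaining ones form \<open>tl p\<close>.\<close>

fun tensor_cells ::
  "('v \<Rightarrow> 'v \<Rightarrow> bool) \<Rightarrow> ('f \<Rightarrow> 'v list \<Rightarrow> 'v list \<Rightarrow> 'v list \<Rightarrow> 'v list \<Rightarrow> complex) \<Rightarrow> 'f list \<Rightarrow>
   'v list \<Rightarrow> 'v list \<Rightarrow> 'v list \<Rightarrow> 'v list \<Rightarrow> complex" where
  "tensor_cells adj \<Phi>f [f] p q \<xi> \<xi>' = \<Phi>f f p q \<xi> \<xi>'"
| "tensor_cells adj \<Phi>f (f # g # fs) p q \<xi> \<xi>' =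
     (\<Sum>\<zeta>\<in>elem_paths adj (length \<xi> - 1).
        \<Phi>f f (take 2 p) (take 2 q) \<xi> \<zeta> * tensor_cells adj \<Phi>f (g # fs) (tl p) (tl q) \<zeta> \<xi>')"

text \<open>Unitarity is required for the columns \<open>(\<xi>, \<beta>)\<close> and \<open>(\<kappa>, \<eta>)\<close> with \<open>r(\<xi>) = s(\<beta>)\<close> and
  \<open>r(\<kappa>) = s(\<eta>)\<close>: by the support condition all other columns vanish identically, so that without
  this restriction the two conditions would contradict each other.\<close>

locale double_triangle_algebra =
  fixes adj :: "'v::finite \<Rightarrow> 'v \<Rightarrow> bool"
    and \<mu> :: "real ^ 'v"
    and mul :: "('v list \<times> 'v list \<Rightarrow> complex) \<Rightarrow> ('v list \<times> 'v list \<Rightarrow> complex) \<Rightarrow>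
                 'v list \<times> 'v list \<Rightarrow> complex"
    and star :: "('v list \<times> 'v list \<Rightarrow> complex) \<Rightarrow> 'v list \<times> 'v list \<Rightarrow> complex"
    and one :: "'v list \<times> 'v list \<Rightarrow> complex"
    and F :: "'f set"
    and \<Phi>f :: "'f \<Rightarrow> 'v list \<Rightarrow> 'v list \<Rightarrow> 'v list \<Rightarrow> 'v list \<Rightarrow> complex"
  assumes cstar: "fd_cstar_algebra (End_gr (essential_deg adj \<mu>)) mul star one"
    and fundamental_irreducible: "f \<in> F \<Longrightarrow>
          irreducible_rep (End_gr (essential_deg adj \<mu>)) mul one (elem_paths adj 1) (cell_rep (\<Phi>f f))"
    and fundamental_star: "f \<in> F \<Longrightarrow>
          star_preserving (End_gr (essential_deg adj \<mu>)) star (elem_paths adj 1) (cell_rep (\<Phi>f f))"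
    and support:
      "\<lbrakk>f \<in> F; \<alpha> \<in> elem_paths adj 1; \<beta> \<in> elem_paths adj 1;
        \<xi> \<in> elem_paths adj n; \<xi>' \<in> elem_paths adj n;
        \<not> (hd \<alpha> = hd \<xi> \<and> last \<alpha> = hd \<xi>' \<and> hd \<beta> = last \<xi> \<and> last \<beta> = last \<xi>')\<rbrakk> \<Longrightarrow>
       \<Phi>f f \<alpha> \<beta> \<xi> \<xi>' = 0"
    and length_zero:
      "\<lbrakk>f \<in> F; \<alpha> \<in> elem_paths adj 1\<rbrakk> \<Longrightarrow>
       \<Phi>f f \<alpha> \<alpha> [v] [v'] = of_bool (hd \<alpha> = v) * of_bool (last \<alpha> = v')"
    and concatenation:
      "\<lbrakk>f \<in> F; \<alpha> \<in> elem_paths adj 1; \<beta> \<in> elem_paths adj 1;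
        \<xi>1 \<in> elem_paths adj m; \<xi>1' \<in> elem_paths adj m;
        \<xi>2 \<in> elem_paths adj n; \<xi>2' \<in> elem_paths adj n\<rbrakk> \<Longrightarrow>
       cell_rep (\<Phi>f f) \<alpha> \<beta> (tensor (path_concat \<xi>1 \<xi>2) (path_concat \<xi>1' \<xi>2')) =
       (if adj (last \<xi>1) (last \<xi>1')
        then \<Phi>f f \<alpha> [last \<xi>1, last \<xi>1'] \<xi>1 \<xi>1' * \<Phi>f f [last \<xi>1, last \<xi>1'] \<beta> \<xi>2 \<xi>2'
        else 0)"
    and unitarity:
      "\<lbrakk>f \<in> F; \<beta> \<in> elem_paths adj 1; \<eta> \<in> elem_paths adj 1;
        \<xi> \<in> elem_paths adj n; \<kappa> \<in> elem_paths adj n; last \<xi> = hd \<beta>; last \<kappa> = hd \<eta>\<rbrakk> \<Longrightarrow>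
       (\<Sum>\<alpha>\<in>elem_paths adj 1. \<Sum>\<xi>'\<in>elem_paths adj n. cnj (\<Phi>f f \<alpha> \<beta> \<xi> \<xi>') * \<Phi>f f \<alpha> \<eta> \<kappa> \<xi>') =
       of_bool (\<beta> = \<eta>) * of_bool (\<xi> = \<kappa>)"
    and reflection:
      "\<lbrakk>f \<in> F; \<alpha> \<in> elem_paths adj 1; \<beta> \<in> elem_paths adj 1;
        \<xi> \<in> elem_paths adj n; \<xi>' \<in> elem_paths adj n;
        c = sqrt (\<mu> $ last \<xi> * \<mu> $ hd \<xi>' / (\<mu> $ hd \<xi> * \<mu> $ last \<xi>'))\<rbrakk> \<Longrightarrow>
       \<Phi>f f \<alpha> \<beta> \<xi> \<xi>' = complex_of_real c * cnj (\<Phi>f f \<beta> \<alpha> (rev \<xi>) (rev \<xi>')) \<and>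
       \<Phi>f f \<alpha> \<beta> \<xi> \<xi>' = complex_of_real c * cnj (\<Phi>f f (rev \<alpha>) (rev \<beta>) \<xi>' \<xi>)"
    and tensor_product_rep:
      "\<lbrakk>fs \<noteq> []; set fs \<subseteq> F\<rbrakk> \<Longrightarrow>
       matrix_rep (End_gr (essential_deg adj \<mu>)) mul one
         (elem_paths adj (length fs)) (cell_rep (tensor_cells adj \<Phi>f fs))"
    and irreps_from_fundamental:
      "irreducible_rep (End_gr (essential_deg adj \<mu>)) mul one {..<d::nat} \<rho> \<Longrightarrow>
       \<exists>fs. fs \<noteq> [] \<and> set fs \<subseteq> F \<and>
         occurs_in (End_gr (essential_deg adj \<mu>)) mul one {..<d} \<rho>
           (elem_paths adj (length fs)) (cell_rep (tensor_cells adj \<Phi>f fs))"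

text \<open>The numbers \<open>\<Psi> x \<eta> \<eta>' \<xi> \<xi>'\<close> are the inverse cells of the irreducible representations \<open>\<Phi> x\<close>
  with respect to the bases \<open>B n\<close>. The matrix of the \<open>\<Phi> x \<eta> \<eta>' (\<xi> \<otimes> \<xi>')\<close> is square, so this
  one-sided identity characterises its inverse.\<close>

definition inverse_cells ::
  "(nat \<Rightarrow> ('b \<Rightarrow> complex) set) \<Rightarrow> 'x set \<Rightarrow> ('x \<Rightarrow> 'i set) \<Rightarrow>
   ('x \<Rightarrow> 'i \<Rightarrow> 'i \<Rightarrow> ('b \<times> 'b \<Rightarrow> complex) \<Rightarrow> complex) \<Rightarrow>
   ('x \<Rightarrow> 'i \<Rightarrow> 'i \<Rightarrow> ('b \<Rightarrow> complex) \<Rightarrow> ('b \<Rightarrow> complex) \<Rightarrow> complex) \<Rightarrow> bool" where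
  "inverse_cells B X I \<Phi> \<Psi> \<longleftrightarrow>
     (\<forall>n1 n2. \<forall>\<xi>1\<in>B n1. \<forall>\<xi>1'\<in>B n1. \<forall>\<xi>2\<in>B n2. \<forall>\<xi>2'\<in>B n2.
        (\<Sum>x\<in>X. \<Sum>\<eta>\<in>I x. \<Sum>\<eta>'\<in>I x. \<Psi> x \<eta> \<eta>' \<xi>1 \<xi>1' * \<Phi> x \<eta> \<eta>' (tensor \<xi>2 \<xi>2')) =
        of_bool (\<xi>1 = \<xi>2) * of_bool (\<xi>1' = \<xi>2'))"

end

theory Submission
  imports Defs
begin

text \<open>The inverse cells provide, for each tensor \<open>\<xi> \<otimes> \<xi>'\<close> of basis elements, the linear functional
  \<open>a \<mapsto> \<Sum> \<Psi>\<^sup>x\<^sub>\<eta>\<^sub>\<eta>\<^sub>'(\<xi> \<otimes> \<xi>') \<Phi>\<^sup>x\<^sub>\<eta>\<^sub>\<eta>\<^sub>'(a)\<close> on the algebra. These functionals are biorthogonal to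
  the tensors, which span the algebra; hence the tensors form a basis with these functionals as
  coordinates. The formula is the coordinate expansion of a product, evaluated with the
  multiplicativity of the \<open>\<Phi>\<^sup>x\<close>.\<close>

text \<open>Applying \<open>L k\<close> to a finite combination of the vectors \<open>v k'\<close>
  reads off its coefficient at \<open>k\<close>. So \<open>v\<close> is injective on
  \<open>K\<close> with independent image, which finite dimension forces to be finite. Finiteness of
  \<open>K\<close> is a conclusion in its own right: a sum over an infinite set would be 0 by
  default.\<close>

lemma biorthogonal_expansion:
  fixes v :: "'k \<Rightarrow> 'b \<Rightarrow> complex" and L :: "'k \<Rightarrow> ('b \<Rightarrow> complex) \<Rightarrow> complex"
  assumes span: "A = cfun.span (v ` K)"
    and fin_dim: "finite S" "A \<subseteq> cfun.span S"
    and add: "\<And>k a b. \<lbrakk>k \<in> K; a \<in> A; b \<in> A\<rbrakk> \<Longrightarrow> L k (a + b) = L k a + L k b"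
    and scale: "\<And>k a z. \<lbrakk>k \<in> K; a \<in> A\<rbrakk> \<Longrightarrow> L k (cscale z a) = z * L k a"
    and biorth: "\<And>k k'. \<lbrakk>k \<in> K; k' \<in> K\<rbrakk> \<Longrightarrow> L k (v k') = of_bool (k = k')"
  shows "finite K" and "a \<in> A \<Longrightarrow> a = (\<Sum>k\<in>K. cscale (L k a) (v k))"
proof -
  have A: "cfun.subspace A" using span by simp
  have vA: "v k \<in> A" if "k \<in> K" for k
    using that span by (simp add: cfun.span_base)
  have zero: "L k 0 = 0" if "k \<in> K" for k
    using scale[of k 0 0] that cfun.subspace_0[OF A] by (simp add: cscale_def zero_fun_def)
  have sum_A: "(\<Sum>t\<in>T. cscale (u t) (v t)) \<in> A" if "T \<subseteq> K" for T u
    using that vA by (intro cfun.subspace_sum[OF A] cfun.subspace_scale[OF A]) auto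
  \<comment> \<open>Stated for finite \<open>T\<close> \<subseteq> \<open>K\<close>, because
    \<open>K\<close> itself is not yet known to be finite.\<close>
  have L_sum: "L k (\<Sum>t\<in>T. cscale (u t) (v t)) = (\<Sum>t\<in>T. u t * of_bool (k = t))"
    if "k \<in> K" "finite T" "T \<subseteq> K" for k T u
    using that(2,3)
  proof induction
    case empty
    show ?case unfolding sum.empty using that(1) by (rule zero)
  next
    case (insert t T)
    have step: "L k (cscale (u t) (v t) + (\<Sum>t\<in>T. cscale (u t) (v t))) =
        u t * L k (v t) + L k (\<Sum>t\<in>T. cscale (u t) (v t))"
      using insert sum_A[of T u] vA[of t] that(1) scale[of k "v t" "u t"]
      by (subst add) (auto intro: cfun.subspace_scale[OF A])
    show ?case
      unfolding sum.insert[OF insert(1,2)] step using insert biorth[of k t] that(1) by simp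
  qed
  have inj: "inj_on v K"
  proof (rule inj_onI)
    fix k k' assume "k \<in> K" "k' \<in> K" "v k = v k'"
    then show "k = k'" using biorth[of k k] biorth[of k k'] by (auto split: if_splits)
  qed
  have "cfun.independent (v ` K)"
    unfolding cfun.dependent_explicit
  proof clarify
    fix T u t assume T: "finite T" "T \<subseteq> v ` K" "(\<Sum>t\<in>T. cscale (u t) t) = 0" "t \<in> T" "u t \<noteq> 0"
    \<comment> \<open>The relation among vectors is pulled back along the injective \<open>v\<close>
      to a relation over indices, to which \<open>L_sum\<close> applies.\<close>
    obtain T' where T': "T' \<subseteq> K" "T = v ` T'" using T(2) by (meson subset_imageE)
    have injT: "inj_on v T'" using inj T' by (rule_tac inj_on_subset) auto
    then have fin: "finite T'" using T T' finite_imageD by blast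
    obtain k where k: "k \<in> T'" "t = v k" using T T' by blast
    have "(\<Sum>t\<in>T'. cscale (u (v t)) (v t)) = 0"
      using T(3) unfolding T'(2) sum.reindex[OF injT] by simp
    then have "(\<Sum>t\<in>T'. u (v t) * of_bool (k = t)) = 0"
      using L_sum[of k T' "\<lambda>t. u (v t)"] zero fin T' k by (metis subsetD)
    then have "u (v k) = 0" using fin k by simp
    then show False using T k by simp
  qed
  \<comment> \<open>An independent set inside the span of the finite set \<open>S\<close> has at
    most \<open>card S\<close> elements.\<close>
  then have "finite (v ` K)"
    using cfun.independent_span_bound[OF fin_dim(1)] fin_dim(2) span cfun.span_superset by blast
  then show fin: "finite K" using inj by (rule finite_imageD)
  show "a = (\<Sum>k\<in>K. cscale (L k a) (v k))" if "a \<in> A"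
  proof -
    have "\<exists>T r. a = (\<Sum>t\<in>T. cscale (r t) t) \<and> finite T \<and> T \<subseteq> v ` K"
      using that unfolding span cfun.span_explicit mem_Collect_eq .
    then obtain T r where T: "finite T" "T \<subseteq> v ` K" "a = (\<Sum>t\<in>T. cscale (r t) t)"
      by (elim exE conjE)
    obtain T' where T': "T' \<subseteq> K" "T = v ` T'" using T(2) by (meson subset_imageE)
    have injT: "inj_on v T'" using inj T' by (rule_tac inj_on_subset) auto
    have fin': "finite T'" using fin T' finite_subset by blast
    have a: "a = (\<Sum>t\<in>T'. cscale (r (v t)) (v t))"
      using T(3) unfolding T'(2) sum.reindex[OF injT] by simp
    \<comment> \<open>The coordinates vanish outside \<open>T'\<close>, so the given combination
      over \<open>T'\<close> extends to the sum over all of \<open>K\<close>.\<close>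
    have L: "L k a = (if k \<in> T' then r (v k) else 0)" if "k \<in> K" for k
      using L_sum[OF that fin' T'(1), of "\<lambda>t. r (v t)"] fin' unfolding a by simp
    have "(\<Sum>k\<in>K. cscale (L k a) (v k)) = (\<Sum>k\<in>T'. cscale (r (v k)) (v k))"
      using fin T'(1) by (intro sum.mono_neutral_cong_right)
        (auto simp: L cscale_def zero_fun_def)
    then show ?thesis using a by simp
  qed
qed

lemma tensor_add_left: "tensor (f + f') g = tensor f g + tensor f' g"
  and tensor_add_right: "tensor f (g + g') = tensor f g + tensor f g'"
  and tensor_scale_left: "tensor (cscale c f) g = cscale c (tensor f g)"
  and tensor_scale_right: "tensor f (cscale c g) = cscale c (tensor f g)"
  and tensor_zero_left: "tensor 0 g = 0"
  and tensor_zero_right: "tensor f 0 = 0"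
  by (auto simp: tensor_def cscale_def fun_eq_iff algebra_simps)

text \<open>Bilinearity, used one argument at a time: the outer induction reduces \<open>f\<close>
  to basis vectors, and the inner one reduces \<open>g\<close> with such a vector \<open>b\<close>
  held fixed.\<close>

lemma tensor_in_span:
  assumes "f \<in> cfun.span B" "g \<in> cfun.span B"
  shows "tensor f g \<in> cfun.span {tensor b b' | b b'. b \<in> B \<and> b' \<in> B}" (is "_ \<in> cfun.span ?T")
  using assms(1)
proof (induction rule: cfun.span_induct_alt)
  case base
  show ?case unfolding tensor_zero_left by (rule cfun.span_zero)
next
  case (step c b y)
  have "tensor b g \<in> cfun.span ?T"
    using assms(2)
  proof (induction rule: cfun.span_induct_alt)
    case base
    show ?case unfolding tensor_zero_right by (rule cfun.span_zero)
  next
    case (step c b' y)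
    then show ?case
      using \<open>b \<in> B\<close> unfolding tensor_add_right tensor_scale_right
      by (blast intro: cfun.span_add cfun.span_scale cfun.span_base)
  qed
  with step show ?case
    unfolding tensor_add_left tensor_scale_left by (blast intro: cfun.span_add cfun.span_scale)
qed

text \<open>Replaces the generators of \<open>End_gr\<close>, which are all homogeneous tensors, by
  tensors of basis vectors, indexed by triples. This is the spanning family that
  \<open>biorthogonal_expansion\<close> requires.\<close>

lemma End_gr_span:
  "End_gr (\<lambda>n. cfun.span (B n)) =
     cfun.span ((\<lambda>(n, b, b'). tensor b b') ` (SIGMA n:UNIV. B n \<times> B n))" (is "_ = cfun.span ?T")
proof
  have "tensor f g \<in> cfun.span ?T" if "f \<in> cfun.span (B n)" "g \<in> cfun.span (B n)" for f g n
    using tensor_in_span[OF that] cfun.span_mono[of "{tensor b b' | b b'. b \<in> B n \<and> b' \<in> B n}" ?T]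
    by force
  then show "End_gr (\<lambda>n. cfun.span (B n)) \<subseteq> cfun.span ?T"
    unfolding End_gr_def by (intro cfun.span_minimal) auto
  show "cfun.span ?T \<subseteq> End_gr (\<lambda>n. cfun.span (B n))"
    unfolding End_gr_def by (intro cfun.span_mono) (force intro: cfun.span_base)
qed

text \<open>A member of an independent set is nonzero, so it has a path in its support, and the
  length of that path determines the degree.\<close>

lemma essential_basis_disjoint:
  assumes "essential_basis adj \<mu> m (B m)" "essential_basis adj \<mu> n (B n)" "b \<in> B m" "b \<in> B n"
  shows "m = n"
proof -
  have "b \<in> essential_deg adj \<mu> m" "b \<in> essential_deg adj \<mu> n"
    using assms cfun.span_base unfolding essential_basis_def by blast+
  moreover have "b \<noteq> 0"
    using assms cfun.dependent_zero unfolding essential_basis_def by blast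
  then obtain p where "b p \<noteq> 0" by (auto simp: fun_eq_iff)
  ultimately have "p \<in> elem_paths adj m" "p \<in> elem_paths adj n"
    unfolding essential_deg_def path_space_deg_def by blast+
  then show ?thesis unfolding elem_paths_def by simp
qed

theorem proposition4p1:
  fixes adj :: "'v::finite \<Rightarrow> 'v \<Rightarrow> bool"
    and \<beta> :: real and \<mu> :: "real ^ 'v"
    and mul :: "('v list \<times> 'v list \<Rightarrow> complex) \<Rightarrow> ('v list \<times> 'v list \<Rightarrow> complex) \<Rightarrow>
                 'v list \<times> 'v list \<Rightarrow> complex"
    and star :: "('v list \<times> 'v list \<Rightarrow> complex) \<Rightarrow> 'v list \<times> 'v list \<Rightarrow> complex"
    and one :: "'v list \<times> 'v list \<Rightarrow> complex"
    and F :: "'f set"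
    and \<Phi>f :: "'f \<Rightarrow> 'v list \<Rightarrow> 'v list \<Rightarrow> 'v list \<Rightarrow> 'v list \<Rightarrow> complex"
    and B :: "nat \<Rightarrow> ('v list \<Rightarrow> complex) set"
    and X :: "'x set" and I :: "'x \<Rightarrow> 'i set"
    and \<Phi> :: "'x \<Rightarrow> 'i \<Rightarrow> 'i \<Rightarrow> ('v list \<times> 'v list \<Rightarrow> complex) \<Rightarrow> complex"
    and \<Psi> :: "'x \<Rightarrow> 'i \<Rightarrow> 'i \<Rightarrow> ('v list \<Rightarrow> complex) \<Rightarrow> ('v list \<Rightarrow> complex) \<Rightarrow> complex"
  assumes "ADE_graph adj"
    and "perron_frobenius adj \<beta> \<mu>"
    and "double_triangle_algebra adj \<mu> mul star one F \<Phi>f"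
    and "\<And>n. essential_basis adj \<mu> n (B n)"
    and "irrep_system (End_gr (essential_deg adj \<mu>)) mul star one X I \<Phi>"
    and "inverse_cells B X I \<Phi> \<Psi>"
    and "\<xi>1 \<in> B n1" and "\<xi>1' \<in> B n1" and "\<xi>2 \<in> B n2" and "\<xi>2' \<in> B n2"
  shows "mul (tensor \<xi>1 \<xi>1') (tensor \<xi>2 \<xi>2') =
    (\<Sum>n3 | B n3 \<noteq> {}. \<Sum>\<xi>3\<in>B n3. \<Sum>\<xi>3'\<in>B n3.
       cscale
         (\<Sum>x\<in>X. \<Sum>\<eta>1\<in>I x. \<Sum>\<eta>2\<in>I x. \<Sum>\<eta>3\<in>I x.
            \<Phi> x \<eta>1 \<eta>2 (tensor \<xi>1 \<xi>1') * \<Phi> x \<eta>2 \<eta>3 (tensor \<xi>2 \<xi>2') * \<Psi> x \<eta>1 \<eta>3 \<xi>3 \<xi>3')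
         (tensor \<xi>3 \<xi>3'))"
proof -
  let ?A = "End_gr (essential_deg adj \<mu>)"
  define K where "K = (SIGMA n:UNIV. B n \<times> B n)"
  define v where "v = (\<lambda>(n :: nat, b :: 'v list \<Rightarrow> complex, b'). tensor b b')"
  define L where "L = (\<lambda>(n :: nat, b, b') a.
    \<Sum>x\<in>X. \<Sum>\<eta>\<in>I x. \<Sum>\<eta>'\<in>I x. \<Psi> x \<eta> \<eta>' b b' * \<Phi> x \<eta> \<eta>' a)"
  define p where "p = mul (tensor \<xi>1 \<xi>1') (tensor \<xi>2 \<xi>2')"
  interpret alg: fd_cstar_algebra ?A mul star one
    using assms(3) unfolding double_triangle_algebra_def by blast
  have rep: "matrix_rep ?A mul one (I x) (\<Phi> x)" if "x \<in> X" for x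
    using assms(5) that unfolding irrep_system_def irreducible_rep_def by blast
  \<comment> \<open>An equality of functions of \<open>n\<close>, since \<open>End_gr\<close> takes
    the whole grading as its argument.\<close>
  have "(\<lambda>n. cfun.span (B n)) = essential_deg adj \<mu>"
    using assms(4) unfolding essential_basis_def by blast
  then have span: "?A = cfun.span (v ` K)"
    using End_gr_span[of B] unfolding v_def K_def by simp
  have vA: "v k \<in> ?A" if "k \<in> K" for k
    using that span by (simp add: cfun.span_base)
  have tA: "tensor \<xi>1 \<xi>1' \<in> ?A" "tensor \<xi>2 \<xi>2' \<in> ?A"
    using vA[of "(n1, \<xi>1, \<xi>1')"] vA[of "(n2, \<xi>2, \<xi>2')"] assms(7-10) by (auto simp: v_def K_def)
  have pA: "p \<in> ?A" unfolding p_def using tA by (rule alg.mult_closed)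
  have L_add: "L k (a + b) = L k a + L k b" if "a \<in> ?A" "b \<in> ?A" for k a b
  proof -
    have "\<Phi> x i j (a + b) = \<Phi> x i j a + \<Phi> x i j b" if "x \<in> X" "i \<in> I x" "j \<in> I x" for x i j
      using rep[OF that(1)] that \<open>a \<in> ?A\<close> \<open>b \<in> ?A\<close> unfolding matrix_rep_def by blast
    then show ?thesis
      unfolding L_def by (simp add: case_prod_unfold sum.distrib[symmetric] distrib_left)
  qed
  have L_scale: "L k (cscale z a) = z * L k a" if "a \<in> ?A" for k a z
  proof -
    have "\<Phi> x i j (cscale z a) = z * \<Phi> x i j a" if "x \<in> X" "i \<in> I x" "j \<in> I x" for x i j
      using rep[OF that(1)] that \<open>a \<in> ?A\<close> unfolding matrix_rep_def by blast
    then show ?thesis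
      unfolding L_def by (simp add: case_prod_unfold sum_distrib_left mult.left_commute)
  qed
  have biorth: "L k (v k') = of_bool (k = k')" if "k \<in> K" "k' \<in> K" for k k'
  proof -
    obtain m b b' n c c' where k: "k = (m, b, b')" "k' = (n, c, c')"
      by (metis prod.collapse)
    have mem: "b \<in> B m" "b' \<in> B m" "c \<in> B n" "c' \<in> B n"
      using that k by (auto simp: K_def)
    have "L k (v k') = of_bool (b = c) * of_bool (b' = c')"
      using assms(6) mem unfolding inverse_cells_def L_def v_def k by simp
    \<comment> \<open>The inverse cell identity compares only the basis vectors. Equality of the
      full triples also needs equal degrees, which the disjointness of the bases supplies.\<close>
    moreover have "m = n" if "b = c"
      using essential_basis_disjoint[where B = B, OF assms(4) assms(4)] mem that by blast
    ultimately show ?thesis unfolding k by auto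
  qed
  obtain S where S: "finite S" "?A \<subseteq> cfun.span S" using alg.finite_dim by blast
  have finK: "finite K"
    by (rule biorthogonal_expansion(1)[OF span S L_add L_scale biorth])
  have expand: "p = (\<Sum>k\<in>K. cscale (L k p) (v k))"
    by (rule biorthogonal_expansion(2)[OF span S L_add L_scale biorth pA])
  let ?N = "{n. B n \<noteq> {}}"
  have K: "K = (SIGMA n:?N. B n \<times> B n)" unfolding K_def by auto
  \<comment> \<open>Finiteness of \<open>K\<close> passes to its projections: only finitely many
    degrees have a nonempty basis, and each \<open>B n\<close> is finite. Both facts are needed to
    split the sum over \<open>K\<close> into iterated sums.\<close>
  have "?N = fst ` K" unfolding K by force
  then have finN: "finite ?N" using finK by simp
  have finB: "finite (B n)" for n
  proof -
    have "B n \<subseteq> (\<lambda>(n, b, b'). b) ` K" unfolding K_def by force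
    then show ?thesis using finK finite_surj by blast
  qed
  have coord: "L (n, b, b') p =
      (\<Sum>x\<in>X. \<Sum>\<eta>1\<in>I x. \<Sum>\<eta>2\<in>I x. \<Sum>\<eta>3\<in>I x.
         \<Phi> x \<eta>1 \<eta>2 (tensor \<xi>1 \<xi>1') * \<Phi> x \<eta>2 \<eta>3 (tensor \<xi>2 \<xi>2') * \<Psi> x \<eta>1 \<eta>3 b b')" for n b b'
  proof -
    have "(\<Sum>\<eta>3\<in>I x. \<Psi> x \<eta>1 \<eta>3 b b' * \<Phi> x \<eta>1 \<eta>3 p) =
        (\<Sum>\<eta>2\<in>I x. \<Sum>\<eta>3\<in>I x.
           \<Phi> x \<eta>1 \<eta>2 (tensor \<xi>1 \<xi>1') * \<Phi> x \<eta>2 \<eta>3 (tensor \<xi>2 \<xi>2') * \<Psi> x \<eta>1 \<eta>3 b b')"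
      if "x \<in> X" "\<eta>1 \<in> I x" for x \<eta>1
    proof -
      \<comment> \<open>Multiplicativity of the representation: the entry of the product is a matrix
        product, with \<eta>2 as the inner index. Exchanging the sums over \<eta>2 and \<eta>3 then
        gives the order in the formula.\<close>
      have "\<Phi> x \<eta>1 \<eta>3 p =
          (\<Sum>\<eta>2\<in>I x. \<Phi> x \<eta>1 \<eta>2 (tensor \<xi>1 \<xi>1') * \<Phi> x \<eta>2 \<eta>3 (tensor \<xi>2 \<xi>2'))"
        if "\<eta>3 \<in> I x" for \<eta>3
        using rep[OF \<open>x \<in> X\<close>] that \<open>\<eta>1 \<in> I x\<close> tA unfolding matrix_rep_def p_def by blast
      then show ?thesis
        by (subst sum.swap) (simp add: sum_distrib_left mult_ac)
    qed
    then show ?thesis unfolding L_def by simp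
  qed
  have "(\<Sum>k\<in>K. cscale (L k p) (v k)) =
      (\<Sum>n\<in>?N. \<Sum>(b, b')\<in>B n \<times> B n. cscale (L (n, b, b') p) (tensor b b'))"
    unfolding K v_def using finN finB by (subst sum.Sigma) (auto simp: case_prod_unfold)
  from trans[OF expand this] show ?thesis
    unfolding p_def[symmetric] coord sum.cartesian_product .
qed

end
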